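(* Let $v>0$ be a constant and let $c_1,c_2$ be real constants with $c_1,c_2\ge \underline c:=\min\{c_1,c_2\}>1$. Consider the system $$\dot\rho=-v\cos\gamma,\qquad \dot\delta=\frac{v}{\rho}\sin\gamma,\qquad \dot\gamma=\frac{v}{\rho}\sin\gamma-\omega$$ in closed loop with the feedback $$\omega=\frac{v}{\rho}\Bigl\{\sin\gamma+\cos^2\gamma\bigl[\cos\gamma\,(1+c_1c_2)\,\delta+(c_1+c_2)\sin\gamma\bigr]\Bigr\}.$$ Define $B(\delta,\gamma):=\sqrt{\delta^2+\tan^2\gamma}$ and $$M(s):=1+\frac{s^2}{2}+s\sqrt{1+\frac{s^2}{4}},\qquad s\ge 0.$$ For all initial conditions $\rho(0)=\rho_0>0$, $\delta(0)=\delta_0\in\mathbb{R}$, $\gamma(0)=\gamma_0\in(-\pi/2,\pi/2)$, write $B_0=B(\delta_0,\gamma_0)$, $B(t)=B(\delta(t),\gamma(t))$, let $\omega(t)$ be the value of the feedback along the solution, and let $$t_1=\frac{\rho_0}{v}\sqrt{1+M^2(c_1)B_0^2}.$$ Let $[0,T)$ be the interval of existence of the solution, at whose end $\rho(T)=0$. Then for all $t\in[0,\min\{t_1,T\})$ the following hold: $$\rho(t)\le\rho_0\,(1-t/t_1),$$ $$B^2(t)\le M^2(c_1)\,(1-t/t_1)^{2\underline c}\,B_0^2,$$ $$|\omega(t)|\le\frac{v}{\rho_0}\,\sqrt2\,\bigl(1+\max\{c_1c_2,\;c_1+c_2\}\bigr)\,M(c_1)\,(1-t/t_1)^{\underline c-1}\,B_0.$$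 In particular, for every $\Omega>0$, the angular velocity $\omega(t)$ is maintained in the interval $[-\Omega,\Omega]$ by choosing the forward velocity $v$ such that $$v\le\Omega\,\frac{\rho_0}{\sqrt{\delta_0^2+\tan^2\gamma_0}}\cdot\frac{1}{\sqrt2\,M(c_1)\,\bigl(1+\max\{c_1c_2,\;c_1+c_2\}\bigr)}.$$
   Context: The system is the unicycle model in polar coordinates: $\rho>0$ is the distance to the origin (the target), $\delta\in\mathbb{R}$ is the polar angle, $\gamma\in\mathbb{R}$ is the line-of-sight angle, $v$ is the forward velocity and $\omega$ is the steering (angular velocity) input. With $v$ a positive constant this is the Dubins vehicle model. The dot denotes the derivative with respect to time $t$. The state space is $\{(\rho,\delta,\gamma):\rho>0,\ \delta,\gamma\in\mathbb{R}\}$; the feedback is singular at $\rho=0$, and solutions are considered up to the time $T$ at which $\rho$ reaches $0$ (i.e. $\rho(t)\to0$ as $t\to T$). *)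

theory Defs
  imports Complex_Main
begin

text \<open>The unicycle in polar coordinates on the time interval \<open>[0,T)\<close>, with constant forward
  velocity \<open>v\<close> and steering input \<open>\<omega>\<close>. The angles are real-valued and not reduced modulo
  \<open>2\<pi>\<close>. Taking derivatives within \<open>[0,T)\<close> makes the one at \<open>0\<close> one-sided.\<close>

definition unicycle_solution ::
  "real \<Rightarrow> (real \<Rightarrow> real) \<Rightarrow> real \<Rightarrow> (real \<Rightarrow> real) \<Rightarrow> (real \<Rightarrow> real) \<Rightarrow> (real \<Rightarrow> real) \<Rightarrow> bool"
  where
  "unicycle_solution v \<omega> T \<rho> \<delta> \<gamma> \<longleftrightarrow>
     (\<forall>t\<in>{0..<T}.
        \<rho> t > 0 \<and>
        (\<rho> has_real_derivative - v * cos (\<gamma> t)) (at t within {0..<T}) \<and>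
        (\<delta> has_real_derivative v / \<rho> t * sin (\<gamma> t)) (at t within {0..<T}) \<and>
        (\<gamma> has_real_derivative v / \<rho> t * sin (\<gamma> t) - \<omega> t) (at t within {0..<T}))"

definition steering_feedback ::
  "real \<Rightarrow> real \<Rightarrow> real \<Rightarrow> real \<Rightarrow> real \<Rightarrow> real \<Rightarrow> real" where
  "steering_feedback v c1 c2 r d g =
     v / r * (sin g + (cos g)\<^sup>2 * (cos g * (1 + c1 * c2) * d + (c1 + c2) * sin g))"

definition B :: "real \<Rightarrow> real \<Rightarrow> real" where
  "B d g = sqrt (d\<^sup>2 + (tan g)\<^sup>2)"

definition M :: "real \<Rightarrow> real" where
  "M s = 1 + s\<^sup>2 / 2 + s * sqrt (1 + s\<^sup>2 / 4)"

end

theory Submission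
  imports Defs
begin

text \<open>In the logarithmic clock \<open>s = - ln \<rho>\<close> the pair \<open>(\<delta>, z)\<close> with \<open>z = tan \<gamma>\<close> obeys the linear system
  \<open>\<delta>' = z\<close>, \<open>z' = - (1 + c1 c2) \<delta> - (c1 + c2) z\<close>. With \<open>\<zeta> = z + c1 \<delta>\<close> this becomes
  \<open>\<delta>' = - c1 \<delta> + \<zeta>\<close>, \<open>\<zeta>' = - \<delta> - c2 \<zeta>\<close>, so \<open>V = \<delta>\<^sup>2 + \<zeta>\<^sup>2\<close> decays like \<open>\<rho>\<close> to the power \<open>2 min c1 c2\<close>.
  The number \<open>M c1\<close> is the squared operator norm of \<open>(\<delta>, z) \<mapsto> (\<delta>, \<zeta>)\<close> and of its inverse, so \<open>B\<close> decays
  with \<open>V\<close>. The resulting bound on \<open>tan \<gamma>\<close> keeps \<open>cos \<gamma>\<close> away from \<open>0\<close>; hence \<open>cos \<gamma>\<close> cannot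
  change sign, and \<open>\<rho>\<close> decreases at least linearly. As \<open>\<rho>\<close> is positive, this forces \<open>T \<le> t1\<close>.\<close>

section \<open>The constant \<open>M\<close> as the squared norm of a shear\<close>

lemma M_ge_1:
  assumes "s \<ge> 0"
  shows "M s \<ge> 1"
  using assms by (simp add: M_def)

text \<open>\<open>M s\<close> is the larger root of
  \<open>x\<^sup>2 - (2 + s\<^sup>2) * x + 1\<close>, the characteristic polynomial of the Gram
  matrix of the shear. Hence the difference of the two sides is a quadratic form of discriminant
  zero.\<close>

lemma M_shear_bound:
  assumes "s > 0"
  shows "d\<^sup>2 + (z + s * d)\<^sup>2 \<le> M s * (d\<^sup>2 + z\<^sup>2)"
proof -
  define q where "q = sqrt (1 + s\<^sup>2 / 4)"
  have q: "q\<^sup>2 = 1 + s\<^sup>2 / 4" "q > 0"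
    unfolding q_def by (simp_all add: add_pos_nonneg)
  have M: "M s = 1 + s\<^sup>2 / 2 + s * q"
    by (simp add: M_def q_def)
  have M1: "M s - 1 > 0"
    unfolding M using assms q(2) by (simp add: add_pos_pos)
  have "(M s - 1) * (M s - 1 - s\<^sup>2) = s\<^sup>2 * q\<^sup>2 - s\<^sup>2 * s\<^sup>2 / 4"
    unfolding M by (simp add: power2_eq_square field_simps)
  also have "\<dots> = s\<^sup>2"
    unfolding q(1) by (simp add: field_simps)
  finally have key: "(M s - 1) * (M s - 1 - s\<^sup>2) = s\<^sup>2" .
  \<comment> \<open>Multiplying the difference by \<open>M s - 1 > 0\<close> turns it, through
    \<open>key\<close>, into a perfect square.\<close>
  have "(M s - 1) * (M s * (d\<^sup>2 + z\<^sup>2) - (d\<^sup>2 + (z + s * d)\<^sup>2))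
      = (M s - 1) * (M s - 1 - s\<^sup>2) * d\<^sup>2 - 2 * s * (M s - 1) * d * z + ((M s - 1) * z)\<^sup>2"
    by (simp add: power2_eq_square algebra_simps)
  also have "\<dots> = (s * d - (M s - 1) * z)\<^sup>2"
    unfolding key by (simp add: power2_eq_square algebra_simps)
  finally have "0 \<le> (M s - 1) * (M s * (d\<^sup>2 + z\<^sup>2) - (d\<^sup>2 + (z + s * d)\<^sup>2))"
    by simp
  with M1 show ?thesis
    by (simp add: zero_le_mult_iff)
qed

text \<open>The reflection of the first coordinate conjugates the inverse shear to the shear itself,
  so both have the same norm.\<close>

lemma M_shear_bound_inverse:
  assumes "s > 0"
  shows "d\<^sup>2 + z\<^sup>2 \<le> M s * (d\<^sup>2 + (z + s * d)\<^sup>2)"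
  using M_shear_bound[OF assms, of "- d" "z + s * d"] by simp

section \<open>Size of the feedback in terms of \<open>B\<close>\<close>

lemma B_squared: "(B d g)\<^sup>2 = d\<^sup>2 + (tan g)\<^sup>2"
  by (simp add: B_def)

lemma B_nonneg: "B d g \<ge> 0"
  by (simp add: B_def)

lemma abs_sum_le_B: "\<bar>d\<bar> + \<bar>tan g\<bar> \<le> sqrt 2 * B d g"
proof (rule power2_le_imp_le)
  have "0 \<le> (\<bar>d\<bar> - \<bar>tan g\<bar>)\<^sup>2" by simp
  then show "(\<bar>d\<bar> + \<bar>tan g\<bar>)\<^sup>2 \<le> (sqrt 2 * B d g)\<^sup>2"
    by (simp add: power_mult_distrib B_squared power2_sum power2_diff)
qed (simp add: B_nonneg)

text \<open>Once \<open>sin g\<close> is written as \<open>cos g * tan g\<close>, the bracket is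
  linear in \<open>d\<close> and \<open>tan g\<close> up to powers of \<open>cos g\<close>, which
  are at most 1. The two remaining coefficients are \<open>1 + c1 * c2\<close> and
  \<open>1 + (c1 + c2)\<close>, hence the maximum; \<open>sqrt 2\<close> comes from comparing the
  sum of absolute values with the Euclidean norm.\<close>

lemma abs_steering_feedback_le:
  assumes "v > 0" "r > 0" "c1 > 0" "c2 > 0" "cos g > 0"
  shows "\<bar>steering_feedback v c1 c2 r d g\<bar>
         \<le> v / r * (sqrt 2 * (1 + max (c1 * c2) (c1 + c2)) * B d g)"
proof -
  define K where "K = 1 + max (c1 * c2) (c1 + c2)"
  have K: "1 + c1 * c2 \<le> K" "1 + (c1 + c2) \<le> K"
    by (simp_all add: K_def)
  have K0: "K \<ge> 0"
    using K(1) mult_pos_pos[OF assms(3,4)] by linarith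
  have sin: "sin g = cos g * tan g"
    using assms(5) by (simp add: tan_def)
  have cos1: "\<bar>cos g\<bar> \<le> 1" "\<bar>cos g ^ 3\<bar> \<le> 1"
    using assms(5) power_le_one[of "cos g" 3] by simp_all
  have "sin g + (cos g)\<^sup>2 * (cos g * (1 + c1 * c2) * d + (c1 + c2) * sin g)
      = cos g * tan g + cos g ^ 3 * ((1 + c1 * c2) * d + (c1 + c2) * tan g)"
    unfolding sin by (simp add: power2_eq_square power3_eq_cube algebra_simps)
  then have "\<bar>sin g + (cos g)\<^sup>2 * (cos g * (1 + c1 * c2) * d + (c1 + c2) * sin g)\<bar>
      \<le> \<bar>cos g\<bar> * \<bar>tan g\<bar> + \<bar>cos g ^ 3\<bar> * \<bar>(1 + c1 * c2) * d + (c1 + c2) * tan g\<bar>"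
    by (metis abs_mult abs_triangle_ineq)
  also have "\<dots> \<le> 1 * \<bar>tan g\<bar> + 1 * \<bar>(1 + c1 * c2) * d + (c1 + c2) * tan g\<bar>"
    by (intro add_mono mult_right_mono cos1) simp_all
  also have "\<dots> \<le> \<bar>tan g\<bar> + ((1 + c1 * c2) * \<bar>d\<bar> + (c1 + c2) * \<bar>tan g\<bar>)"
    using abs_triangle_ineq[of "(1 + c1 * c2) * d" "(c1 + c2) * tan g"] assms(3,4)
    by (simp add: abs_mult)
  also have "\<dots> = (1 + c1 * c2) * \<bar>d\<bar> + (1 + (c1 + c2)) * \<bar>tan g\<bar>"
    by (simp add: algebra_simps)
  also have "\<dots> \<le> K * \<bar>d\<bar> + K * \<bar>tan g\<bar>"
    by (intro add_mono mult_right_mono K) simp_all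
  also have "\<dots> \<le> K * (sqrt 2 * B d g)"
    using mult_left_mono[OF abs_sum_le_B K0] by (simp add: distrib_left)
  finally show ?thesis
    using assms(1,2) unfolding steering_feedback_def K_def[symmetric]
    by (simp add: abs_mult mult_left_mono divide_right_mono mult_ac)
qed

text \<open>Derivatives within \<open>{0..<T}\<close> are two-sided at interior points and one-sided
  at 0, where continuity is enough for monotonicity.\<close>

lemma DERIV_nonpos_within_imp_le:
  fixes f :: "real \<Rightarrow> real"
  assumes deriv: "\<And>s. s \<in> {0..t} \<Longrightarrow> (f has_real_derivative f' s) (at s within {0..<T})"
    and nonpos: "\<And>s. s \<in> {0..t} \<Longrightarrow> f' s \<le> 0"
    and t: "t \<in> {0..<T}"
  shows "f t \<le> f 0"
proof (rule DERIV_nonpos_imp_decreasing_open[of 0 t f])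
  show "0 \<le> t" using t by simp
  show "\<exists>y. (f has_real_derivative y) (at s) \<and> y \<le> 0" if "0 < s" "s < t" for s
  proof -
    have "(f has_real_derivative f' s) (at s within {0<..<T})"
      by (rule DERIV_subset[OF deriv]) (use that in auto)
    moreover have "at s within {0<..<T} = at s"
      by (rule at_within_open) (use that t in auto)
    ultimately show ?thesis using nonpos[of s] that by auto
  qed
  have "continuous (at s within {0..t}) f" if "s \<in> {0..t}" for s
    by (rule DERIV_continuous[OF DERIV_subset[OF deriv[OF that]]]) (use t in auto)
  then show "continuous_on {0..t} f"
    by (simp add: continuous_on_eq_continuous_within)
qed

section \<open>Closed-loop equations in the logarithmic clock\<close>

context
  fixes v c1 c2 T :: real and \<rho> \<delta> \<gamma> \<omega> :: "real \<Rightarrow> real"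
  assumes v: "v > 0"
    and c: "min c1 c2 > 1"
    and solution: "unicycle_solution v \<omega> T \<rho> \<delta> \<gamma>"
    and feedback: "\<forall>t\<in>{0..<T}. \<omega> t = steering_feedback v c1 c2 (\<rho> t) (\<delta> t) (\<gamma> t)"
begin

lemma rho_pos: "t \<in> {0..<T} \<Longrightarrow> \<rho> t > 0"
  using solution by (auto simp: unicycle_solution_def)

lemma rho_deriv:
  "t \<in> {0..<T} \<Longrightarrow> (\<rho> has_real_derivative - v * cos (\<gamma> t)) (at t within {0..<T})"
  using solution by (auto simp: unicycle_solution_def)

text \<open>The factor \<open>v * cos (\<gamma> t) / \<rho> t\<close> is the rate of the clock
  \<open>- ln \<rho>\<close>; it is kept separate here and in the next two derivatives.\<close>

lemma delta_deriv:
  assumes "t \<in> {0..<T}" "cos (\<gamma> t) > 0"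
  shows "(\<delta> has_real_derivative v * cos (\<gamma> t) / \<rho> t * tan (\<gamma> t)) (at t within {0..<T})"
proof -
  have "v / \<rho> t * sin (\<gamma> t) = v * cos (\<gamma> t) / \<rho> t * tan (\<gamma> t)"
    using assms(2) by (simp add: tan_def)
  then show ?thesis
    using solution assms(1) by (metis unicycle_solution_def)
qed

text \<open>The leading \<open>sin\<close> of the feedback cancels the drift of
  \<open>\<gamma>\<close>, and its factor \<open>cos\<^sup>2\<close> cancels the derivative of
  \<open>tan\<close>. What is left is linear.\<close>

lemma tan_gamma_deriv:
  assumes t: "t \<in> {0..<T}" and pos: "cos (\<gamma> t) > 0"
  shows "((\<lambda>t. tan (\<gamma> t)) has_real_derivative
     - (v * cos (\<gamma> t) / \<rho> t * ((1 + c1 * c2) * \<delta> t + (c1 + c2) * tan (\<gamma> t)))) (at t within {0..<T})"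
proof -
  have sin: "sin (\<gamma> t) = cos (\<gamma> t) * tan (\<gamma> t)"
    using pos by (simp add: tan_def)
  have "(\<gamma> has_real_derivative v / \<rho> t * sin (\<gamma> t) - \<omega> t) (at t within {0..<T})"
    using solution t by (simp add: unicycle_solution_def)
  then have "((\<lambda>t. tan (\<gamma> t)) has_real_derivative
      inverse ((cos (\<gamma> t))\<^sup>2) * (v / \<rho> t * sin (\<gamma> t) - \<omega> t)) (at t within {0..<T})"
    by (rule DERIV_chain2[OF DERIV_tan, rotated]) (use pos in simp)
  moreover have "inverse ((cos (\<gamma> t))\<^sup>2) * (v / \<rho> t * sin (\<gamma> t) - \<omega> t)
      = - (v * cos (\<gamma> t) / \<rho> t * ((1 + c1 * c2) * \<delta> t + (c1 + c2) * tan (\<gamma> t)))"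
    unfolding feedback[rule_format, OF t] steering_feedback_def sin
    using pos rho_pos[OF t] by (simp add: field_simps power2_eq_square)
  ultimately show ?thesis by simp
qed

definition V :: "real \<Rightarrow> real"
  where "V t = (\<delta> t)\<^sup>2 + (tan (\<gamma> t) + c1 * \<delta> t)\<^sup>2"

text \<open>The gains \<open>1 + c1 * c2\<close> and \<open>c1 + c2\<close> are such that the cross
  terms between \<open>\<delta>\<close> and \<open>tan \<gamma> + c1 * \<delta>\<close>
  cancel.\<close>

lemma V_deriv:
  assumes "t \<in> {0..<T}" "cos (\<gamma> t) > 0"
  shows "(V has_real_derivative
     - (2 * (v * cos (\<gamma> t) / \<rho> t) * (c1 * (\<delta> t)\<^sup>2 + c2 * (tan (\<gamma> t) + c1 * \<delta> t)\<^sup>2))) (at t within {0..<T})"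
  unfolding V_def[abs_def]
  by (rule derivative_eq_intros delta_deriv[OF assms] tan_gamma_deriv[OF assms] refl)+
     (simp add: algebra_simps power2_eq_square add_divide_distrib)

lemma V_decay:
  assumes t: "t \<in> {0..<T}" and pos: "\<And>s. s \<in> {0..t} \<Longrightarrow> cos (\<gamma> s) > 0"
  shows "V t \<le> V 0 * (\<rho> t / \<rho> 0) powr (2 * min c1 c2)"
proof -
  define m where "m = min c1 c2"
  \<comment> \<open>The integrating factor \<open>\<rho> powr (- 2 * m)\<close> is
    \<open>exp (2 * m * s)\<close> in the clock \<open>s = - ln \<rho>\<close>, so decay of
    \<open>V\<close> at rate \<open>2 * m\<close> means that \<open>E\<close> does not
    increase.\<close>
  define E where "E s = V s * \<rho> s powr (- 2 * m)" for s
  define E' where "E' s = - (2 * (v * cos (\<gamma> s) / \<rho> s) *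
      (c1 * (\<delta> s)\<^sup>2 + c2 * (tan (\<gamma> s) + c1 * \<delta> s)\<^sup>2 - m * V s)) * \<rho> s powr (- 2 * m)" for s
  have "E t \<le> E 0"
  proof (rule DERIV_nonpos_within_imp_le)
    fix s assume s: "s \<in> {0..t}"
    then have sT: "s \<in> {0..<T}" using t by auto
    note r = rho_pos[OF sT]
    have "((\<lambda>s. \<rho> s powr (- 2 * m)) has_real_derivative
        (- 2 * m) * \<rho> s powr (- 2 * m - 1) * (- v * cos (\<gamma> s))) (at s within {0..<T})"
      by (rule DERIV_chain2[OF has_real_derivative_powr[OF r] rho_deriv[OF sT]])
    then have "((\<lambda>s. \<rho> s powr (- 2 * m)) has_real_derivative
        2 * m * (v * cos (\<gamma> s) / \<rho> s) * \<rho> s powr (- 2 * m)) (at s within {0..<T})"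
      using r by (simp add: powr_diff mult_ac)
    from DERIV_mult[OF V_deriv[OF sT pos[OF s]] this]
    show "(E has_real_derivative E' s) (at s within {0..<T})"
      unfolding E_def[abs_def] E'_def by (rule DERIV_cong) (simp add: algebra_simps)
    have "m * (\<delta> s)\<^sup>2 + m * (tan (\<gamma> s) + c1 * \<delta> s)\<^sup>2
        \<le> c1 * (\<delta> s)\<^sup>2 + c2 * (tan (\<gamma> s) + c1 * \<delta> s)\<^sup>2"
      by (intro add_mono mult_right_mono) (simp_all add: m_def)
    then have "0 \<le> c1 * (\<delta> s)\<^sup>2 + c2 * (tan (\<gamma> s) + c1 * \<delta> s)\<^sup>2 - m * V s"
      by (simp add: V_def distrib_left)
    then show "E' s \<le> 0"
      unfolding E'_def using pos[OF s] v r by simp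
  qed (rule t)
  moreover have "\<rho> t > 0" "\<rho> 0 > 0" using rho_pos t by auto
  ultimately show ?thesis
    unfolding E_def m_def[symmetric]
    by (simp add: powr_minus powr_divide field_simps)
qed

text \<open>One factor \<open>M c1\<close> is lost in passing from \<open>B\<close> to
  \<open>V\<close> at time \<open>t\<close>, the other in passing back at time 0.\<close>

lemma B_decay:
  assumes t: "t \<in> {0..<T}" and pos: "\<And>s. s \<in> {0..t} \<Longrightarrow> cos (\<gamma> s) > 0"
  shows "(B (\<delta> t) (\<gamma> t))\<^sup>2
         \<le> (M c1)\<^sup>2 * (\<rho> t / \<rho> 0) powr (2 * min c1 c2) * (B (\<delta> 0) (\<gamma> 0))\<^sup>2"
proof -
  have c1: "c1 > 0" using c by simp
  have M0: "M c1 \<ge> 0" using M_ge_1[of c1] c1 by simp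
  have "(B (\<delta> t) (\<gamma> t))\<^sup>2 \<le> M c1 * V t"
    unfolding B_squared V_def by (rule M_shear_bound_inverse[OF c1])
  also have "\<dots> \<le> M c1 * (V 0 * (\<rho> t / \<rho> 0) powr (2 * min c1 c2))"
    by (intro mult_left_mono V_decay[OF t pos] M0)
  also have "\<dots> \<le> M c1 * (M c1 * (B (\<delta> 0) (\<gamma> 0))\<^sup>2 * (\<rho> t / \<rho> 0) powr (2 * min c1 c2))"
    unfolding B_squared V_def
    by (intro mult_left_mono mult_right_mono M_shear_bound[OF c1] M0) simp
  finally show ?thesis by (simp add: power2_eq_square mult_ac)
qed

section \<open>Positivity of \<open>cos \<gamma>\<close> and linear decrease of the distance\<close>

lemma cos_lower_bound:
  assumes t: "t \<in> {0..<T}" and pos: "\<And>s. s \<in> {0..t} \<Longrightarrow> cos (\<gamma> s) > 0"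
  shows "cos (\<gamma> t) \<ge> 1 / sqrt (1 + (M c1)\<^sup>2 * (B (\<delta> 0) (\<gamma> 0))\<^sup>2)"
proof -
  have r: "\<rho> t > 0" "\<rho> 0 > 0" using rho_pos t by auto
  have "\<rho> t \<le> \<rho> 0"
    by (rule DERIV_nonpos_within_imp_le[OF rho_deriv _ t])
       (use t pos v in \<open>auto intro!: mult_nonneg_nonneg less_imp_le\<close>)
  \<comment> \<open>Dropping the power leaves a bound that depends on the initial data only. This
    uniformity drives the continuation argument in \<open>cos_pos\<close>.\<close>
  then have "(\<rho> t / \<rho> 0) powr (2 * min c1 c2) \<le> 1"
    using r c by (intro powr_le1) auto
  then have "(M c1)\<^sup>2 * (\<rho> t / \<rho> 0) powr (2 * min c1 c2) * (B (\<delta> 0) (\<gamma> 0))\<^sup>2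
      \<le> (M c1)\<^sup>2 * 1 * (B (\<delta> 0) (\<gamma> 0))\<^sup>2"
    by (intro mult_left_mono mult_right_mono) simp_all
  then have "(tan (\<gamma> t))\<^sup>2 \<le> (M c1)\<^sup>2 * (B (\<delta> 0) (\<gamma> 0))\<^sup>2"
    using B_decay[OF assms] zero_le_power2[of "\<delta> t"] unfolding B_squared[of "\<delta> t"] by linarith
  moreover have p: "cos (\<gamma> t) > 0" using pos t by simp
  have "1 + (tan (\<gamma> t))\<^sup>2 = (1 / cos (\<gamma> t))\<^sup>2"
    using p tan_sec[of "\<gamma> t"] by (simp add: inverse_eq_divide power_divide)
  ultimately have "(1 / cos (\<gamma> t))\<^sup>2 \<le> 1 + (M c1)\<^sup>2 * (B (\<delta> 0) (\<gamma> 0))\<^sup>2"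
    by linarith
  then have "1 / cos (\<gamma> t) \<le> sqrt (1 + (M c1)\<^sup>2 * (B (\<delta> 0) (\<gamma> 0))\<^sup>2)"
    by (rule real_le_rsqrt)
  moreover have "sqrt (1 + (M c1)\<^sup>2 * (B (\<delta> 0) (\<gamma> 0))\<^sup>2) > 0"
    by (simp add: add_pos_nonneg)
  ultimately show ?thesis
    using p by (simp add: field_simps)
qed

text \<open>Continuation argument: up to the first zero of the cosine the uniform bound
  \<open>k\<close> would hold, so by continuity the cosine cannot reach 0.\<close>

lemma cos_pos:
  assumes init: "cos (\<gamma> 0) > 0" and t: "t \<in> {0..<T}"
  shows "cos (\<gamma> t) > 0"
proof (rule ccontr)
  assume neg: "\<not> cos (\<gamma> t) > 0"
  have "continuous (at s within {0..<T}) \<gamma>" if "s \<in> {0..<T}" for s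
    using solution that unfolding unicycle_solution_def by (metis DERIV_continuous)
  then have "continuous_on {0..<T} \<gamma>"
    by (simp add: continuous_on_eq_continuous_within)
  then have cont: "continuous_on {0..t} (\<lambda>s. cos (\<gamma> s))"
    by (intro continuous_on_cos) (rule continuous_on_subset, use t in auto)
  define k where "k = 1 / sqrt (1 + (M c1)\<^sup>2 * (B (\<delta> 0) (\<gamma> 0))\<^sup>2)"
  have k: "k > 0" by (simp add: k_def add_pos_nonneg)
  define S where "S = {s \<in> {0..t}. cos (\<gamma> s) \<le> 0}"
  have "closed S"
    using continuous_on_closed_vimage[OF closed_atLeastAtMost, THEN iffD1, OF cont,
        rule_format, OF closed_atMost[of 0]]
    by (simp add: S_def vimage_def Int_def conj_commute)
  then have "compact ({0..t} \<inter> S)"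
    by (intro compact_Int_closed compact_Icc)
  then have "compact S"
    by (rule back_subst) (auto simp: S_def)
  then obtain u where "u \<in> S" and min: "\<And>s. s \<in> S \<Longrightarrow> u \<le> s"
    using compact_attains_inf[of S] neg t by (fastforce simp: S_def)
  then have u: "u \<in> {0..t}" "cos (\<gamma> u) \<le> 0"
    by (auto simp: S_def)
  have before: "cos (\<gamma> s) > 0" if "0 \<le> s" "s < u" for s
    using min[of s] that u by (force simp: S_def)
  have ge_k: "cos (\<gamma> s) \<ge> k" if "0 \<le> s" "s < u" for s
    unfolding k_def by (rule cos_lower_bound) (use that u t before in auto)
  have "u > 0" using u init by (cases "u = 0") auto
  \<comment> \<open>The minimum puts the target value between \<open>cos (\<gamma> u)\<close> and
    \<open>cos (\<gamma> 0)\<close> while keeping it positive and below \<open>k\<close>.\<close>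
  obtain y where y: "0 \<le> y" "y \<le> u" "cos (\<gamma> y) = min (k / 2) (cos (\<gamma> 0))"
    using IVT2'[of "\<lambda>s. cos (\<gamma> s)" u "min (k / 2) (cos (\<gamma> 0))" 0] u init k
      continuous_on_subset[OF cont, of "{0..u}"] by fastforce
  then have "y \<noteq> u" using u init k by (auto simp: min_def split: if_splits)
  with y ge_k[of y] k show False by (auto simp: min_def split: if_splits)
qed

text \<open>The speed of approach is at least \<open>v / R\<close>, and \<open>t1\<close> is the
  time at which the line of slope \<open>- v / R\<close> from \<open>\<rho> 0\<close> reaches
  0.\<close>

lemma rho_linear_decay:
  assumes init: "cos (\<gamma> 0) > 0" and t: "t \<in> {0..<T}"
    and t1: "t1 = \<rho> 0 / v * sqrt (1 + (M c1)\<^sup>2 * (B (\<delta> 0) (\<gamma> 0))\<^sup>2)"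
  shows "\<rho> t \<le> \<rho> 0 * (1 - t / t1)"
proof -
  define R where "R = sqrt (1 + (M c1)\<^sup>2 * (B (\<delta> 0) (\<gamma> 0))\<^sup>2)"
  have "\<rho> t + v / R * t \<le> \<rho> 0 + v / R * 0"
  proof (rule DERIV_nonpos_within_imp_le[where f = "\<lambda>s. \<rho> s + v / R * s", OF _ _ t])
    fix s assume "s \<in> {0..t}"
    then have s: "s \<in> {0..<T}" using t by auto
    show "((\<lambda>s. \<rho> s + v / R * s) has_real_derivative - v * cos (\<gamma> s) + v / R)
        (at s within {0..<T})"
      by (rule derivative_eq_intros rho_deriv[OF s] refl)+ simp
    have "cos (\<gamma> s) \<ge> 1 / R"
      unfolding R_def by (rule cos_lower_bound) (use s cos_pos[OF init] in auto)
    then show "- v * cos (\<gamma> s) + v / R \<le> 0"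
      using v mult_left_mono[of "1 / R" "cos (\<gamma> s)" v] by simp
  qed
  moreover have "\<rho> 0 * (t / t1) = v / R * t"
    using rho_pos[of 0] t v by (simp add: t1 R_def)
  ultimately show ?thesis by (simp add: right_diff_distrib)
qed

end

section \<open>Bounds in time and the choice of the forward velocity\<close>

theorem theorem1:
  fixes v c1 c2 \<rho>0 \<delta>0 \<gamma>0 T t1 B0 :: real
    and \<rho> \<delta> \<gamma> \<omega> :: "real \<Rightarrow> real"
  assumes "v > 0"
    and "min c1 c2 > 1"
    and "\<rho>0 > 0" and "\<gamma>0 \<in> {-pi/2<..<pi/2}"
    and "T > 0"
    and "unicycle_solution v \<omega> T \<rho> \<delta> \<gamma>"
    and "\<forall>t\<in>{0..<T}. \<omega> t = steering_feedback v c1 c2 (\<rho> t) (\<delta> t) (\<gamma> t)"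
    and "\<rho> 0 = \<rho>0" and "\<delta> 0 = \<delta>0" and "\<gamma> 0 = \<gamma>0"
    and "(\<rho> \<longlongrightarrow> 0) (at_left T)"
    and "B0 = B \<delta>0 \<gamma>0"
    and "t1 = \<rho>0 / v * sqrt (1 + (M c1)\<^sup>2 * B0\<^sup>2)"
  shows "(\<forall>t\<in>{0..<min t1 T}.
            \<rho> t \<le> \<rho>0 * (1 - t / t1) \<and>
            (B (\<delta> t) (\<gamma> t))\<^sup>2 \<le> (M c1)\<^sup>2 * (1 - t / t1) powr (2 * min c1 c2) * B0\<^sup>2 \<and>
            \<bar>\<omega> t\<bar> \<le> v / \<rho>0 * sqrt 2 * (1 + max (c1 * c2) (c1 + c2)) * M c1
                      * (1 - t / t1) powr (min c1 c2 - 1) * B0)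
       \<and> (\<forall>\<Omega>>0.
            (B0 \<noteq> 0 \<longrightarrow>
               v \<le> \<Omega> * (\<rho>0 / sqrt (\<delta>0\<^sup>2 + (tan \<gamma>0)\<^sup>2))
                     * (1 / (sqrt 2 * M c1 * (1 + max (c1 * c2) (c1 + c2)))))
            \<longrightarrow> (\<forall>t\<in>{0..<T}. \<omega> t \<in> {-\<Omega>..\<Omega>}))"
proof -
  have v: "v > 0" and c: "min c1 c2 > 1" and r0: "\<rho>0 > 0" by fact+
  note sol = assms(6) and fb = assms(7)
  define K where "K = 1 + max (c1 * c2) (c1 + c2)"
  have c': "c1 > 0" "c2 > 0" using c by auto
  have K: "K > 0" using c' unfolding K_def by (simp add: add_pos_pos max_def)
  have M: "M c1 > 0" using M_ge_1[of c1] c' by simp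
  have B0: "B0 = B (\<delta> 0) (\<gamma> 0)" "B0 \<ge> 0"
    using assms(9,10,12) by (simp_all add: B_nonneg)
  have init: "cos (\<gamma> 0) > 0"
    using assms(4,10) by (simp add: cos_gt_zero_pi)
  have R: "sqrt (1 + (M c1)\<^sup>2 * B0\<^sup>2) > 0"
    by (simp add: add_pos_nonneg)
  then have t1: "t1 > 0" unfolding assms(13) using v r0 by simp
  \<comment> \<open>The bounds are proved on all of \<open>{0..<T}\<close>, the range of the final
    claim on \<open>\<omega>\<close>. There \<open>1 - t / t1\<close> stays nonnegative because
    \<open>\<rho>\<close> is positive and below the linear bound.\<close>
  have bounds: "\<rho> t \<le> \<rho>0 * (1 - t / t1) \<and>
      (B (\<delta> t) (\<gamma> t))\<^sup>2 \<le> (M c1)\<^sup>2 * (1 - t / t1) powr (2 * min c1 c2) * B0\<^sup>2 \<and>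
      \<bar>\<omega> t\<bar> \<le> v / \<rho>0 * sqrt 2 * K * M c1 * (1 - t / t1) powr (min c1 c2 - 1) * B0 \<and>
      0 \<le> 1 - t / t1 \<and> 1 - t / t1 \<le> 1"
    if t: "t \<in> {0..<T}" for t
  proof -
    define m where "m = min c1 c2"
    define x where "x = \<rho> t / \<rho>0"
    define y where "y = 1 - t / t1"
    have m: "m > 1" using c by (simp add: m_def)
    have r: "\<rho> t > 0" by (rule rho_pos[OF v c sol fb t])
    have lin: "\<rho> t \<le> \<rho>0 * y"
      using rho_linear_decay[OF v c sol fb init t, of t1] assms(8,13) B0(1) by (simp add: y_def)
    have x: "0 < x" "x \<le> y"
      using r r0 lin by (simp_all add: x_def field_simps)
    have B: "(B (\<delta> t) (\<gamma> t))\<^sup>2 \<le> (M c1)\<^sup>2 * x powr (2 * m) * B0\<^sup>2"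
      using B_decay[OF v c sol fb t cos_pos[OF v c sol fb init]] t assms(8) B0(1)
      by (simp add: x_def m_def)
    have "(M c1)\<^sup>2 * x powr (2 * m) * B0\<^sup>2 \<le> (M c1)\<^sup>2 * y powr (2 * m) * B0\<^sup>2"
      using x m by (intro mult_left_mono mult_right_mono powr_mono2) simp_all
    with B have By: "(B (\<delta> t) (\<gamma> t))\<^sup>2 \<le> (M c1)\<^sup>2 * y powr (2 * m) * B0\<^sup>2"
      by simp
    have "B (\<delta> t) (\<gamma> t) \<le> M c1 * x powr m * B0"
    proof (rule power2_le_imp_le)
      have "x powr (2 * m) = (x powr m)\<^sup>2"
        by (simp add: power2_eq_square flip: powr_add)
      then show "(B (\<delta> t) (\<gamma> t))\<^sup>2 \<le> (M c1 * x powr m * B0)\<^sup>2"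
        using B by (simp add: power_mult_distrib)
    qed (use M B0 in simp)
    then have "v / \<rho> t * (sqrt 2 * K * B (\<delta> t) (\<gamma> t))
        \<le> v / \<rho> t * (sqrt 2 * K * (M c1 * x powr m * B0))"
      using v r K by (intro mult_left_mono) simp_all
    \<comment> \<open>The singular factor \<open>1 / \<rho> t\<close> costs one power of
      \<open>x\<close>. It has to be absorbed before \<open>x\<close> is replaced by
      \<open>y\<close>, since the upper bound on \<open>\<rho> t\<close> bounds
      \<open>1 / \<rho> t\<close> only from below; \<open>m > 1\<close> then makes the remaining
      power monotone.\<close>
    also have "\<dots> = v / \<rho>0 * sqrt 2 * K * M c1 * x powr (m - 1) * B0"
      using r r0 by (simp add: powr_diff x_def)
    also have "\<dots> \<le> v / \<rho>0 * sqrt 2 * K * M c1 * y powr (m - 1) * B0"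
      using x m v r0 K M B0 by (intro mult_left_mono mult_right_mono powr_mono2) simp_all
    finally have "\<bar>\<omega> t\<bar> \<le> v / \<rho>0 * sqrt 2 * K * M c1 * y powr (m - 1) * B0"
      using abs_steering_feedback_le[OF v r c' cos_pos[OF v c sol fb init t], of "\<delta> t"] fb t
      by (simp add: K_def)
    moreover have "0 \<le> y" "y \<le> 1" using x t t1 by (simp, simp add: y_def)
    ultimately show ?thesis using lin By unfolding y_def m_def by blast
  qed
  have "\<omega> t \<in> {- \<Omega>..\<Omega>}"
    if "\<Omega> > 0" and small: "B0 \<noteq> 0 \<longrightarrow> v \<le> \<Omega> * (\<rho>0 / sqrt (\<delta>0\<^sup>2 + (tan \<gamma>0)\<^sup>2)) * (1 / (sqrt 2 * M c1 * K))"
      and t: "t \<in> {0..<T}" for \<Omega> t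
  proof -
    have "(1 - t / t1) powr (min c1 c2 - 1) \<le> 1"
      using bounds[OF t] c by (intro powr_le1) simp_all
    then have "v / \<rho>0 * sqrt 2 * K * M c1 * (1 - t / t1) powr (min c1 c2 - 1) * B0
        \<le> v / \<rho>0 * sqrt 2 * K * M c1 * 1 * B0"
      using v r0 K M B0 by (intro mult_left_mono mult_right_mono) simp_all
    also have "\<dots> \<le> \<Omega>"
    \<comment> \<open>For \<open>B0 = 0\<close> the left side vanishes; otherwise the claim is the
      condition on \<open>v\<close> solved for \<open>\<Omega>\<close>.\<close>
    proof (cases "B0 = 0")
      case False
      then have "B0 > 0" using B0 by simp
      then show ?thesis
        using small False r0 K M by (simp add: assms(12) B_def field_simps)
    qed (use that in simp)
    finally show ?thesis using bounds[OF t] by (simp add: abs_le_iff)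
  qed
  with bounds show ?thesis unfolding K_def by auto
qed

end
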